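(* Let $I\subset[0,\infty)$ be an interval, let $a,b\in I$ with $a<b$, and let $f:I\to\mathbb{R}$ be differentiable on the interior $I^{\circ}$ of $I$ and at $a$ and $b$, with $f'\in L[a,b]$. Let $s\in(0,1]$ be fixed and suppose that $|f'|$ is $s$-convex in the second sense on $[a,b]$. Then for each $x\in[a,b]$, $$\left|f(x)-\frac{1}{b-a}\int_a^b f(u)\,du\right|\le \frac{b-a}{(s+1)(s+2)}\Big\{\Big[2(s+1)\Big(\tfrac{b-x}{b-a}\Big)^{s+2}-(s+2)\Big(\tfrac{b-x}{b-a}\Big)^{s+1}+1\Big]|f'(a)|+\Big[2(s+1)\Big(\tfrac{x-a}{b-a}\Big)^{s+2}-(s+2)\Big(\tfrac{x-a}{b-a}\Big)^{s+1}+1\Big]|f'(b)|\Big\}.$$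
   Context: For fixed $s\in(0,1]$, a real function $g$ is $s$-convex in the second sense on $[a,b]\subset[0,\infty)$ if $g(\alpha x+(1-\alpha)y)\le \alpha^s g(x)+(1-\alpha)^s g(y)$ for all $x,y\in[a,b]$ and $\alpha\in[0,1]$. $L[a,b]$ denotes the Lebesgue integrable functions on $[a,b]$. If $a$ or $b$ is an endpoint of $I$, differentiability there is one-sided (within $I$). *)

theory Defs
  imports "HOL-Analysis.Analysis"
begin

text \<open>
  \<open>s\<close>-convexity in the second sense on \<open>S\<close>, for \<open>0 < s \<le> 1\<close> and an interval \<open>S\<close> of nonnegative
  reals; both conditions are left to the user of the definition. For \<open>s > 0\<close> the convention
  \<open>0 powr s = 0\<close> agrees with the usual value of \<open>0\<^sup>s\<close> at the endpoints \<open>t = 0\<close> and \<open>t = 1\<close>.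
\<close>

definition s_convex_on :: "real \<Rightarrow> real set \<Rightarrow> (real \<Rightarrow> real) \<Rightarrow> bool" where
  "s_convex_on s S g \<longleftrightarrow>
     (\<forall>x\<in>S. \<forall>y\<in>S. \<forall>t\<in>{0..1}.
        g (t * x + (1 - t) * y) \<le> t powr s * g x + (1 - t) powr s * g y)"

end

theory Submission
  imports Defs
begin

text \<open>
  Integrating by parts with the kernel \<open>u - a\<close> on \<open>[a, x]\<close> and \<open>u - b\<close> on \<open>[x, b]\<close> gives
  \<open>(b - a) f(x) - \<integral> f = \<integral>\<^sub>a\<^sup>x (u - a) f'(u) du + \<integral>\<^sub>x\<^sup>b (u - b) f'(u) du\<close>.
  Writing \<open>u\<close> as a convex combination of \<open>a\<close> and \<open>b\<close>, \<open>s\<close>-convexity bounds \<open>|f'(u)|\<close> by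
  \<open>((b - u)/(b - a))\<^sup>s |f'(a)| + ((u - a)/(b - a))\<^sup>s |f'(b)|\<close>, and the resulting integrals are
  elementary. The second one is the mirror image of the first under \<open>u \<mapsto> -u\<close>.
\<close>

text \<open>\<open>A\<close> and \<open>B\<close> stay free weights, not tied to end values of
  \<open>g'\<close>, so that the reflected function can be fed in with the two interchanged. The
  bound is in closed form because the majorant of \<open>\<bar>(u - a) * g' u\<bar>\<close> has an
  elementary antiderivative.\<close>

lemma one_sided_ostrowski_bound:
  fixes g g' :: "real \<Rightarrow> real" and a b x s A B :: real
  assumes ab: "a < b" and x: "a \<le> x" "x \<le> b" and s: "0 < s"
    and deriv: "\<And>u. u \<in> {a..x} \<Longrightarrow> (g has_real_derivative g' u) (at u within {a..x})"
    and bound: "\<And>u. u \<in> {a..x} \<Longrightarrow>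
      \<bar>g' u\<bar> \<le> ((b - u) / (b - a)) powr s * A + ((u - a) / (b - a)) powr s * B"
  shows "\<bar>(x - a) * g x - integral {a..x} g\<bar> \<le>
    (b - a)\<^sup>2 * (A * ((1 - ((b - x) / (b - a)) powr (s + 1)) / (s + 1)
                  - (1 - ((b - x) / (b - a)) powr (s + 2)) / (s + 2))
             + B * (((x - a) / (b - a)) powr (s + 2) / (s + 2)))"
proof -
  have "continuous_on {a..x} g"
    using deriv by (metis DERIV_continuous_on)
  then have g_int: "(g has_integral integral {a..x} g) {a..x}"
    by (simp add: integrable_continuous_real integrable_integral)
  \<comment> \<open>Integration by parts as the fundamental theorem for the gauge integral:
    \<open>g'\<close> may be discontinuous, and the kernel \<open>u - a\<close> kills the boundary
    term at \<open>a\<close>.\<close>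
  have "((\<lambda>u. (u - a) * g u) has_real_derivative g u + (u - a) * g' u) (at u within {a..x})"
    if "u \<in> {a..x}" for u
    by (rule derivative_eq_intros deriv that refl | simp)+
  then have "((\<lambda>u. g u + (u - a) * g' u) has_integral (x - a) * g x - (a - a) * g a) {a..x}"
    by (intro fundamental_theorem_of_calculus)
       (auto simp: x has_real_derivative_iff_has_vector_derivative)
  from has_integral_diff[OF this g_int]
  have lhs: "((\<lambda>u. (u - a) * g' u) has_integral (x - a) * g x - integral {a..x} g) {a..x}"
    by simp
  \<comment> \<open>With \<open>v = (b - u) / (b - a)\<close> and
    \<open>w = (u - a) / (b - a)\<close>, \<open>u - a\<close> is
    \<open>(b - a) * w = (b - a) * (1 - v)\<close>. The majorant is then \<open>b - a\<close> times
    \<open>A * (v powr s - v powr (s + 1)) + B * w powr (s + 1)\<close>, and changing variables to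
    \<open>v\<close> or \<open>w\<close> yields the second factor \<open>b - a\<close>.\<close>
  define G where "G = (\<lambda>u. (b - a)\<^sup>2 *
    (A * (((b - u) / (b - a)) powr (s + 2) / (s + 2) - ((b - u) / (b - a)) powr (s + 1) / (s + 1))
     + B * (((u - a) / (b - a)) powr (s + 2) / (s + 2))))"
  have G_deriv: "(G has_real_derivative
      (u - a) * (((b - u) / (b - a)) powr s * A + ((u - a) / (b - a)) powr s * B)) (at u)"
    \<comment> \<open>Differentiating \<open>powr\<close> here requires a positive base, but
      \<open>w\<close> vanishes at \<open>a\<close>, and \<open>v\<close> at \<open>x\<close> when
      \<open>x = b\<close>. At the endpoints continuity of \<open>G\<close> suffices.\<close>
    if u: "u \<in> {a<..<x}" for u
  proof -
    define v where "v = (b - u) / (b - a)"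
    define w where "w = (u - a) / (b - a)"
    have pos: "v > 0" "w > 0" "b - a > 0"
      using u x ab by (auto simp: v_def w_def)
    have dv: "((\<lambda>u. (b - u) / (b - a)) has_real_derivative - 1 / (b - a)) (at u)"
      and dw: "((\<lambda>u. (u - a) / (b - a)) has_real_derivative 1 / (b - a)) (at u)"
      by (rule DERIV_cdivide; (auto intro!: derivative_eq_intros))+
    have pd: "((\<lambda>u. f u powr r / r) has_real_derivative f u powr (r - 1) * d) (at u)"
      if "(f has_real_derivative d) (at u)" "f u > 0" "r > 0" for f d and r :: real
      using DERIV_cdivide[OF DERIV_fun_powr[OF that(1,2)], of r r] that
      by simp
    have deriv_G: "(G has_real_derivative (b - a)\<^sup>2 *
        (A * (v powr (s + 2 - 1) * (- 1 / (b - a)) - v powr (s + 1 - 1) * (- 1 / (b - a)))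
         + B * (w powr (s + 2 - 1) * (1 / (b - a))))) (at u)"
      unfolding G_def v_def w_def
      by (intro DERIV_cmult DERIV_add DERIV_diff pd dv dw)
         (use pos s in \<open>auto simp: v_def w_def\<close>)
    have powers: "v powr (s + 2 - 1) = v powr s * v" "v powr (s + 1 - 1) = v powr s"
        "w powr (s + 2 - 1) = w powr s * w"
      using pos by (simp_all add: powr_add mult.commute)
    have algebra: "h\<^sup>2 * (A * (V * v * (- 1 / h) - V * (- 1 / h)) + B * (W * w * (1 / h)))
        = w * h * (V * A + W * B)" if "v = 1 - w" "h > 0" for V W h
      unfolding that(1) using that(2) by (simp add: field_simps power2_eq_square)
    have v_eq: "v = 1 - w"
      using ab by (simp add: v_def w_def field_simps)
    have w_eq: "w * (b - a) = u - a"
      using ab by (simp add: w_def)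
    show ?thesis
      using deriv_G unfolding powers algebra[OF v_eq pos(3)] w_eq
      unfolding v_def w_def .
  qed
  have cont: "continuous_on {a..x} (\<lambda>u. ((b - u) / (b - a)) powr r)"
    "continuous_on {a..x} (\<lambda>u. ((u - a) / (b - a)) powr r)" if "r > 0" for r
    by (rule continuous_on_powr'; use that x ab in \<open>force intro!: continuous_intros\<close>)+
  have "continuous_on {a..x} G"
    unfolding G_def using s
    by (intro continuous_on_mult continuous_on_add continuous_on_diff continuous_on_divide
        continuous_on_const cont) auto
  then have rhs: "((\<lambda>u. (u - a) * (((b - u) / (b - a)) powr s * A + ((u - a) / (b - a)) powr s * B))
      has_integral G x - G a) {a..x}"
    using x G_deriv
    by (intro fundamental_theorem_of_calculus_interior)
       (auto simp: has_real_derivative_iff_has_vector_derivative)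
  have "\<bar>(u - a) * g' u\<bar> \<le> (u - a) * (((b - u) / (b - a)) powr s * A + ((u - a) / (b - a)) powr s * B)"
    if "u \<in> {a..x}" for u
    using mult_left_mono[OF bound[OF that], of "u - a"] that by (simp add: abs_mult)
  with Henstock_Kurzweil_Integration.integral_norm_bound_integral[OF
      has_integral_integrable[OF lhs] has_integral_integrable[OF rhs]]
  have "\<bar>(x - a) * g x - integral {a..x} g\<bar> \<le> G x - G a"
    using integral_unique[OF lhs] integral_unique[OF rhs] by simp
  also have "\<dots> = (b - a)\<^sup>2 * (A * ((1 - ((b - x) / (b - a)) powr (s + 1)) / (s + 1)
                  - (1 - ((b - x) / (b - a)) powr (s + 2)) / (s + 2))
             + B * (((x - a) / (b - a)) powr (s + 2) / (s + 2)))"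
  proof -
    have "h * (A * (c2 / p - c1 / q) + B * (d / p)) - h * (A * (1 / p - 1 / q) + B * (0 / p))
        = h * (A * ((1 - c1) / q - (1 - c2) / p) + B * (d / p))" for h c1 c2 d p q :: real
      by (simp add: algebra_simps diff_divide_distrib)
    \<comment> \<open>These evaluate \<open>G a\<close>; \<open>0 powr r = 0\<close> removes its
      \<open>B\<close> term.\<close>
    moreover have "((b - a) / (b - a)) powr r = 1" "((a - a) / (b - a)) powr r = 0" for r
      using ab by simp_all
    ultimately show ?thesis
      unfolding G_def by (simp only:)
  qed
  finally show ?thesis .
qed

theorem theorem7:
  fixes I :: "real set" and a b s x :: real and f f' :: "real \<Rightarrow> real"
  assumes I_interval: "is_interval I" and I_nonneg: "I \<subseteq> {0..}"
    and a_in: "a \<in> I" and b_in: "b \<in> I" and a_less_b: "a < b"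
    and deriv_interior: "\<And>u. u \<in> interior I \<Longrightarrow> (f has_real_derivative f' u) (at u)"
    and deriv_a: "(f has_real_derivative f' a) (at a within I)"
    and deriv_b: "(f has_real_derivative f' b) (at b within I)"
    and f'_integrable: "set_integrable lebesgue {a..b} f'"
    and s_pos: "0 < s" and s_le_1: "s \<le> 1"
    and f'_s_convex: "s_convex_on s {a..b} (\<lambda>u. \<bar>f' u\<bar>)"
    and x_in: "x \<in> {a..b}"
  shows "\<bar>f x - 1 / (b - a) * (LINT u:{a..b}|lebesgue. f u)\<bar>
    \<le> (b - a) / ((s + 1) * (s + 2)) *
      ((2 * (s + 1) * ((b - x) / (b - a)) powr (s + 2)
          - (s + 2) * ((b - x) / (b - a)) powr (s + 1) + 1) * \<bar>f' a\<bar>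
       + (2 * (s + 1) * ((x - a) / (b - a)) powr (s + 2)
          - (s + 2) * ((x - a) / (b - a)) powr (s + 1) + 1) * \<bar>f' b\<bar>)"
proof -
  define I1 where "I1 = integral {a..x} f"
  define I2 where "I2 = integral {x..b} f"
  define A where "A = \<bar>f' a\<bar>"
  define B where "B = \<bar>f' b\<bar>"
  define c where "c = (b - x) / (b - a)"
  define d where "d = (x - a) / (b - a)"
  have x: "a \<le> x" "x \<le> b" using x_in by auto
  have sub: "{a..b} \<subseteq> I"
    by (meson atLeastAtMost_iff subsetI mem_is_interval_1_I[OF I_interval a_in b_in])
  then have "{a<..<b} \<subseteq> interior I"
    by (intro interior_maximal) (auto simp: subset_iff)
  then have deriv: "(f has_real_derivative f' u) (at u within {a..b})" if "u \<in> {a..b}" for u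
  proof -
    \<comment> \<open>At \<open>a\<close> and \<open>b\<close> the derivative within
      \<open>I\<close> restricts to \<open>{a..b}\<close>, whether or not these are endpoints of
      \<open>I\<close>.\<close>
    consider "u = a" | "u = b" | "u \<in> interior I"
      using \<open>{a<..<b} \<subseteq> interior I\<close> \<open>u \<in> {a..b}\<close> by force
    then show ?thesis
      by cases (use sub deriv_a deriv_b deriv_interior in
          \<open>auto intro: has_field_derivative_subset has_field_derivative_at_within\<close>)
  qed
  have bound: "\<bar>f' u\<bar> \<le> ((b - u) / (b - a)) powr s * A + ((u - a) / (b - a)) powr s * B"
    if "u \<in> {a..b}" for u
  proof -
    have "(b - u) / (b - a) \<in> {0..1}" using that a_less_b by auto
    moreover have "1 - (b - u) / (b - a) = (u - a) / (b - a)"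
      using a_less_b by (simp add: field_simps)
    moreover have "(b - u) / (b - a) * a + (u - a) / (b - a) * b = u"
    proof -
      have "(b - u) * a + (u - a) * b = u * (b - a)" by (simp add: algebra_simps)
      then show ?thesis using a_less_b by (simp add: add_divide_distrib[symmetric])
    qed
    ultimately show ?thesis
      using f'_s_convex a_less_b unfolding s_convex_on_def A_def B_def
      by (metis atLeastAtMost_iff less_eq_real_def)
  qed
  have left: "\<bar>(x - a) * f x - I1\<bar> \<le> (b - a)\<^sup>2 *
      (A * ((1 - c powr (s + 1)) / (s + 1) - (1 - c powr (s + 2)) / (s + 2))
       + B * (d powr (s + 2) / (s + 2)))"
    unfolding I1_def c_def d_def
    by (rule one_sided_ostrowski_bound[where g' = f'])
       (use x a_less_b s_pos bound in \<open>auto intro: has_field_derivative_subset[OF deriv]\<close>)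
  \<comment> \<open>Reflection puts \<open>- b\<close>, \<open>- a\<close>, \<open>- x\<close> in
    the places of \<open>a\<close>, \<open>b\<close>, \<open>x\<close>. This exchanges the ratios
    \<open>c\<close> and \<open>d\<close>, and hence the weights \<open>A\<close> and
    \<open>B\<close>.\<close>
  have "\<bar>(- x - (- b)) * f (- (- x)) - integral {- b..- x} (\<lambda>u. f (- u))\<bar> \<le> (- a - (- b))\<^sup>2 *
      (B * ((1 - ((- a - (- x)) / (- a - (- b))) powr (s + 1)) / (s + 1)
            - (1 - ((- a - (- x)) / (- a - (- b))) powr (s + 2)) / (s + 2))
       + A * (((- x - (- b)) / (- a - (- b))) powr (s + 2) / (s + 2)))"
  proof (rule one_sided_ostrowski_bound[where g' = "\<lambda>u. - f' (- u)"])
    fix u assume u: "u \<in> {- b..- x}"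
    have "(f has_real_derivative f' (- u)) (at (- u) within uminus ` {- b..- x})"
      by (rule has_field_derivative_subset[OF deriv]) (use u x in auto)
    from DERIV_image_chain[OF this DERIV_minus[OF DERIV_ident]]
    show "((\<lambda>u. f (- u)) has_real_derivative - f' (- u)) (at u within {- b..- x})"
      by (simp add: o_def)
    show "\<bar>- f' (- u)\<bar> \<le> ((- a - u) / (- a - (- b))) powr s * B + ((u - (- b)) / (- a - (- b))) powr s * A"
      using bound[of "- u"] u x by (simp add: add.commute minus_diff_commute[of u a])
  qed (use x a_less_b s_pos in auto)
  then have right: "\<bar>(b - x) * f x - I2\<bar> \<le> (b - a)\<^sup>2 *
      (B * ((1 - d powr (s + 1)) / (s + 1) - (1 - d powr (s + 2)) / (s + 2))
       + A * (c powr (s + 2) / (s + 2)))"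
    unfolding I2_def c_def d_def by simp
  \<comment> \<open>Continuity makes \<open>f\<close> absolutely integrable, so its Lebesgue and
    gauge integrals agree.\<close>
  have cont: "continuous_on {a..b} f"
    using deriv by (metis DERIV_continuous_on)
  then have "(LINT u:{a..b}|lebesgue. f u) = integral {a..b} f"
    by (intro set_lebesgue_integral_eq_integral absolutely_integrable_continuous_real)
  also have "\<dots> = I1 + I2"
    unfolding I1_def I2_def using x cont
    by (simp add: Henstock_Kurzweil_Integration.integral_combine integrable_continuous_real)
  finally have int: "(LINT u:{a..b}|lebesgue. f u) = I1 + I2" .
  \<comment> \<open>The lengths \<open>x - a\<close> and \<open>b - x\<close> add up to
    \<open>b - a\<close>, so the two one-sided errors sum to the full one.\<close>
  have "f x - 1 / (b - a) * (I1 + I2) = (((x - a) * f x - I1) + ((b - x) * f x - I2)) / (b - a)"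
    using a_less_b by (simp add: field_simps)
  also have "\<bar>\<dots>\<bar> \<le> (\<bar>(x - a) * f x - I1\<bar> + \<bar>(b - x) * f x - I2\<bar>) / (b - a)"
    using a_less_b by (simp add: divide_right_mono)
  also have "\<dots> \<le> (b - a)\<^sup>2 *
      (A * ((1 - c powr (s + 1)) / (s + 1) - (1 - c powr (s + 2)) / (s + 2) + c powr (s + 2) / (s + 2))
       + B * ((1 - d powr (s + 1)) / (s + 1) - (1 - d powr (s + 2)) / (s + 2) + d powr (s + 2) / (s + 2)))
      / (b - a)"
    using add_mono[OF left right] a_less_b by (intro divide_right_mono) (simp_all add: distrib_left)
  finally have "\<bar>f x - 1 / (b - a) * (I1 + I2)\<bar> \<le> (b - a)\<^sup>2 *
      (A * ((1 - c powr (s + 1)) / (s + 1) - (1 - c powr (s + 2)) / (s + 2) + c powr (s + 2) / (s + 2))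
       + B * ((1 - d powr (s + 1)) / (s + 1) - (1 - d powr (s + 2)) / (s + 2) + d powr (s + 2) / (s + 2)))
      / (b - a)" .
  \<comment> \<open>Used with powers of \<open>c\<close> for the weight \<open>A\<close> and of
    \<open>d\<close> for \<open>B\<close>. The two copies of \<open>q / (s + 2)\<close> produce the
    factor \<open>2 * (s + 1)\<close>, and \<open>1 / (s + 1) - 1 / (s + 2)\<close> produces the
    constant \<open>1\<close>.\<close>
  moreover have "(1 - p) / (s + 1) - (1 - q) / (s + 2) + q / (s + 2)
      = (2 * (s + 1) * q - (s + 2) * p + 1) / ((s + 1) * (s + 2))" for p q
    using s_pos by (simp add: divide_simps) (simp add: algebra_simps)
  \<comment> \<open>Division by zero gives zero, so this holds for all \<open>h\<close> and
    \<open>r\<close> and rewrites without side conditions.\<close>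
  moreover have "h\<^sup>2 * (A * (p / r) + B * (q / r)) / h = h / r * (p * A + q * B)" for h p q r :: real
    by (cases "h = 0") (simp_all add: power2_eq_square add_divide_distrib algebra_simps)
  ultimately show ?thesis
    unfolding int A_def B_def c_def d_def by (simp only:)
qed

end
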